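(* The assignments $\alpha(E,\mathrm{en})=(E,\mathrm{en}_0)$ and $\beta(E,\mathrm{dep})=(E,\mathrm{en}_{\mathrm{dep}})$, where $\mathrm{en}_{\mathrm{dep}}(e)=\{X\subseteq E:\exists Y\subseteq X,\ Y\in\mathrm{dep}(e)\}$, both acting as the identity on underlying functions of morphisms, define mutually inverse functors between the category $\mathsf{DES}$ of dependency event structures and the category $\mathsf{DSC}$ of dependency structures with choice, giving an isomorphism of categories $\mathsf{DES}\cong\mathsf{DSC}$.
   Context: $P(A)$ denotes the power set of $A$. DSCs. A preDSC is a pair $(E,\mathrm{dep})$ with $E$ a finite set and $\mathrm{dep}:E\to P(P(E))$ a function; elements of $\mathrm{dep}(e)$ are called depsets of $e$. For $X,Y\subseteq E$ write $X\,\mathrm{rch}\,Y$ if $X\subseteq Y$ and for every $y\in Y$ there is $D\in\mathrm{dep}(y)$ with $D\subseteq X$. A subset $X\subseteq E$ is reachable if there is a finite sequence of subsets with $\varnothing\,\mathrm{rch}\,X_0\,\mathrm{rch}\cdots\mathrm{rch}\,X_n\,\mathrm{rch}\,X$. A subset $X$ is complete if every $e\in X$ has a depset $D\in\mathrm{dep}(e)$ with $D\subseteq X$. A DSC is a preDSC which is irredundant ($D_0\subseteq D_1$ with $D_0,D_1\in\mathrm{dep}(e)$ implies $D_0=D_1$), acyclic ($e\notin D$ for all $D\in\mathrm{dep}(e)$), nonsingular ($\mathrm{dep}(e)\neq\varnothing$ for all $e$) and has complete depsets (all $D\in\mathrm{dep}(e)$ are complete). A morphism of DSCs is a function $f:E\to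 E'$ such that $f^{-1}(X)$ is reachable for every reachable $X\subseteq E'$. Event structures. A conflict-free event structure (CFES) is a pair $(E,\mathrm{en})$ with $E$ a finite set and $\mathrm{en}:E\to P(P(E))$ such that $X\in\mathrm{en}(e)$ and $X\subseteq Y\subseteq E$ imply $Y\in\mathrm{en}(e)$. A configuration is a subset $X\subseteq E$ such that for every $e\in X$ there is a finite sequence $e_0,\dots,e_n\in X$ with $e_n=e$ and $\{e_0,\dots,e_{i-1}\}\in\mathrm{en}(e_i)$ for all $0\le i\le n$ (for $i=0$ this set is empty). A morphism of CFESs is a function $f:E\to E'$ such that $f^{-1}(X)$ is a configuration of $E$ for every configuration $X\subseteq E'$. $X$ is a minimal enabling set for $e$, written $X\in\mathrm{en}_0(e)$, if $X\in\mathrm{en}(e)$ and $Y\subseteq X$, $Y\in\mathrm{en}(e)$ imply $Y=X$. A dependency event structure is a CFES that is acyclic ($X\in\mathrm{en}_0(e)$ implies $e\notin X$), nonsingular ($\mathrm{en}(e)\ne\varnothing$ for all $e$) and has configurable minimal enabling sets (every $X\in\mathrm{en}_0(e)$ is a configuration, for all $e$). $\mathsf{DES}$ is the full subcategory of the category of CFESs on the dependency event structures. *)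

theory Defs
  imports Main "HOL-Library.FuncSet"
begin

section \<open>Categories, functors, isomorphisms of categories\<close>

record ('o, 'm) cat =
  Obj :: "'o set"
  Arr :: "'m set"
  Dom :: "'m \<Rightarrow> 'o"
  Cod :: "'m \<Rightarrow> 'o"
  Idn :: "'o \<Rightarrow> 'm"
  Comp :: "'m \<Rightarrow> 'm \<Rightarrow> 'm"

text \<open>\<open>Comp C g f\<close> is ``g after f''; it is only constrained on composable pairs of arrows.\<close>

locale category =
  fixes C :: "('o, 'm) cat"
  assumes Dom_Obj: "f \<in> Arr C \<Longrightarrow> Dom C f \<in> Obj C"
    and Cod_Obj: "f \<in> Arr C \<Longrightarrow> Cod C f \<in> Obj C"
    and Idn_Arr: "A \<in> Obj C \<Longrightarrow> Idn C A \<in> Arr C"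
    and Dom_Idn: "A \<in> Obj C \<Longrightarrow> Dom C (Idn C A) = A"
    and Cod_Idn: "A \<in> Obj C \<Longrightarrow> Cod C (Idn C A) = A"
    and Comp_Arr:
      "f \<in> Arr C \<Longrightarrow> g \<in> Arr C \<Longrightarrow> Cod C f = Dom C g \<Longrightarrow> Comp C g f \<in> Arr C"
    and Dom_Comp:
      "f \<in> Arr C \<Longrightarrow> g \<in> Arr C \<Longrightarrow> Cod C f = Dom C g \<Longrightarrow> Dom C (Comp C g f) = Dom C f"
    and Cod_Comp:
      "f \<in> Arr C \<Longrightarrow> g \<in> Arr C \<Longrightarrow> Cod C f = Dom C g \<Longrightarrow> Cod C (Comp C g f) = Cod C g"
    and Comp_Idn_right: "f \<in> Arr C \<Longrightarrow> Comp C f (Idn C (Dom C f)) = f"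
    and Comp_Idn_left: "f \<in> Arr C \<Longrightarrow> Comp C (Idn C (Cod C f)) f = f"
    and Comp_assoc:
      "f \<in> Arr C \<Longrightarrow> g \<in> Arr C \<Longrightarrow> h \<in> Arr C \<Longrightarrow>
       Cod C f = Dom C g \<Longrightarrow> Cod C g = Dom C h \<Longrightarrow>
       Comp C h (Comp C g f) = Comp C (Comp C h g) f"

definition full_subcategory :: "('o, 'm) cat \<Rightarrow> 'o set \<Rightarrow> ('o, 'm) cat" where
  "full_subcategory C S =
     C\<lparr>Obj := Obj C \<inter> S, Arr := {f \<in> Arr C. Dom C f \<in> S \<and> Cod C f \<in> S}\<rparr>"

record ('o1, 'm1, 'o2, 'm2) cat_map =
  onObj :: "'o1 \<Rightarrow> 'o2"
  onArr :: "'m1 \<Rightarrow> 'm2"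

locale is_functor = src: category C + tgt: category D
  for C :: "('o1, 'm1) cat" and D :: "('o2, 'm2) cat" +
  fixes F :: "('o1, 'm1, 'o2, 'm2) cat_map"
  assumes onObj_Obj: "A \<in> Obj C \<Longrightarrow> onObj F A \<in> Obj D"
    and onArr_Arr: "f \<in> Arr C \<Longrightarrow> onArr F f \<in> Arr D"
    and Dom_onArr: "f \<in> Arr C \<Longrightarrow> Dom D (onArr F f) = onObj F (Dom C f)"
    and Cod_onArr: "f \<in> Arr C \<Longrightarrow> Cod D (onArr F f) = onObj F (Cod C f)"
    and onArr_Idn: "A \<in> Obj C \<Longrightarrow> onArr F (Idn C A) = Idn D (onObj F A)"
    and onArr_Comp:
      "f \<in> Arr C \<Longrightarrow> g \<in> Arr C \<Longrightarrow> Cod C f = Dom C g \<Longrightarrow>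
       onArr F (Comp C g f) = Comp D (onArr F g) (onArr F f)"

definition mutually_inverse ::
  "('o1, 'm1) cat \<Rightarrow> ('o2, 'm2) cat \<Rightarrow>
   ('o1, 'm1, 'o2, 'm2) cat_map \<Rightarrow> ('o2, 'm2, 'o1, 'm1) cat_map \<Rightarrow> bool" where
  "mutually_inverse C D F G \<longleftrightarrow>
     (\<forall>A\<in>Obj C. onObj G (onObj F A) = A) \<and>
     (\<forall>f\<in>Arr C. onArr G (onArr F f) = f) \<and>
     (\<forall>B\<in>Obj D. onObj F (onObj G B) = B) \<and>
     (\<forall>g\<in>Arr D. onArr F (onArr G g) = g)"

definition isomorphic_categories :: "('o1, 'm1) cat \<Rightarrow> ('o2, 'm2) cat \<Rightarrow> bool" where
  "isomorphic_categories C D \<longleftrightarrow>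
     (\<exists>F G. is_functor C D F \<and> is_functor D C G \<and> mutually_inverse C D F G)"


section \<open>Set systems and their arrows\<close>

text \<open>
  A pair \<open>(E, s)\<close> with \<open>s : E \<rightarrow> P(P(E))\<close>. Maps with domain \<open>E\<close> are extensional
  (\<open>undefined\<close> off \<open>E\<close>), so that equality of HOL functions is equality of maps on \<open>E\<close>.
  Ground sets are finite subsets of an arbitrary type \<open>'a\<close>.
\<close>

type_synonym 'a system = "'a set \<times> ('a \<Rightarrow> 'a set set)"

definition is_system :: "'a system \<Rightarrow> bool" where
  "is_system A \<longleftrightarrow> finite (fst A) \<and> snd A \<in> fst A \<rightarrow>\<^sub>E Pow (Pow (fst A))"

text \<open>An arrow carries its source and target, as the underlying function does not determine them.\<close>

type_synonym 'a arrow = "'a system \<times> ('a \<Rightarrow> 'a) \<times> 'a system"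

definition concrete_cat ::
  "'a system set \<Rightarrow> ('a system \<Rightarrow> 'a system \<Rightarrow> ('a \<Rightarrow> 'a) set) \<Rightarrow> ('a system, 'a arrow) cat" where
  "concrete_cat S hom =
     \<lparr>Obj = S,
      Arr = {(A, f, B). A \<in> S \<and> B \<in> S \<and> f \<in> hom A B},
      Dom = (\<lambda>(A, f, B). A),
      Cod = (\<lambda>(A, f, B). B),
      Idn = (\<lambda>A. (A, (\<lambda>x\<in>fst A. x), A)),
      Comp = (\<lambda>(B', g, C) (A, f, B). (A, compose (fst A) g f, C))\<rparr>"


section \<open>Dependency structures with choice\<close>

abbreviation preDSC :: "'a system \<Rightarrow> bool" where
  "preDSC A \<equiv> is_system A"

definition rch :: "'a system \<Rightarrow> 'a set \<Rightarrow> 'a set \<Rightarrow> bool" where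
  "rch A X Y \<longleftrightarrow> X \<subseteq> fst A \<and> Y \<subseteq> fst A \<and> X \<subseteq> Y \<and> (\<forall>y\<in>Y. \<exists>D\<in>snd A y. D \<subseteq> X)"

definition reachable :: "'a system \<Rightarrow> 'a set \<Rightarrow> bool" where
  "reachable A X \<longleftrightarrow> X \<subseteq> fst A \<and>
     (\<exists>(n::nat) S. rch A {} (S 0) \<and> (\<forall>i<n. rch A (S i) (S (Suc i))) \<and> rch A (S n) X)"

definition complete :: "'a system \<Rightarrow> 'a set \<Rightarrow> bool" where
  "complete A X \<longleftrightarrow> X \<subseteq> fst A \<and> (\<forall>e\<in>X. \<exists>D\<in>snd A e. D \<subseteq> X)"

definition is_DSC :: "'a system \<Rightarrow> bool" where
  "is_DSC A \<longleftrightarrow> preDSC A \<and>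
     (\<forall>e\<in>fst A. \<forall>D0\<in>snd A e. \<forall>D1\<in>snd A e. D0 \<subseteq> D1 \<longrightarrow> D0 = D1) \<and>
     (\<forall>e\<in>fst A. \<forall>D\<in>snd A e. e \<notin> D) \<and>
     (\<forall>e\<in>fst A. snd A e \<noteq> {}) \<and>
     (\<forall>e\<in>fst A. \<forall>D\<in>snd A e. complete A D)"

definition DSC_hom :: "'a system \<Rightarrow> 'a system \<Rightarrow> ('a \<Rightarrow> 'a) set" where
  "DSC_hom A B =
     {f \<in> fst A \<rightarrow>\<^sub>E fst B. \<forall>X. reachable B X \<longrightarrow> reachable A (f -` X \<inter> fst A)}"

definition DSC :: "('a system, 'a arrow) cat" where
  "DSC = concrete_cat {A. is_DSC A} DSC_hom"


section \<open>Dependency event structures\<close>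

definition is_CFES :: "'a system \<Rightarrow> bool" where
  "is_CFES A \<longleftrightarrow> is_system A \<and>
     (\<forall>e\<in>fst A. \<forall>X Y. X \<in> snd A e \<longrightarrow> X \<subseteq> Y \<longrightarrow> Y \<subseteq> fst A \<longrightarrow> Y \<in> snd A e)"

definition configuration :: "'a system \<Rightarrow> 'a set \<Rightarrow> bool" where
  "configuration A X \<longleftrightarrow> X \<subseteq> fst A \<and>
     (\<forall>e\<in>X. \<exists>(n::nat) s. (\<forall>i\<le>n. s i \<in> X) \<and> s n = e \<and> (\<forall>i\<le>n. s ` {..<i} \<in> snd A (s i)))"

definition CFES_hom :: "'a system \<Rightarrow> 'a system \<Rightarrow> ('a \<Rightarrow> 'a) set" where
  "CFES_hom A B =
     {f \<in> fst A \<rightarrow>\<^sub>E fst B. \<forall>X. configuration B X \<longrightarrow> configuration A (f -` X \<inter> fst A)}"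

definition CFES :: "('a system, 'a arrow) cat" where
  "CFES = concrete_cat {A. is_CFES A} CFES_hom"

definition min_enabling :: "'a system \<Rightarrow> 'a \<Rightarrow> 'a set set" where
  "min_enabling A = (\<lambda>e\<in>fst A. {X \<in> snd A e. \<forall>Y. Y \<subseteq> X \<and> Y \<in> snd A e \<longrightarrow> Y = X})"

definition is_DES :: "'a system \<Rightarrow> bool" where
  "is_DES A \<longleftrightarrow> is_CFES A \<and>
     (\<forall>e\<in>fst A. \<forall>X\<in>min_enabling A e. e \<notin> X) \<and>
     (\<forall>e\<in>fst A. snd A e \<noteq> {}) \<and>
     (\<forall>e\<in>fst A. \<forall>X\<in>min_enabling A e. configuration A X)"

definition DES :: "('a system, 'a arrow) cat" where
  "DES = full_subcategory CFES {A. is_DES A}"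


section \<open>The two assignments\<close>

definition en_of_dep :: "'a system \<Rightarrow> 'a \<Rightarrow> 'a set set" where
  "en_of_dep A = (\<lambda>e\<in>fst A. {X. X \<subseteq> fst A \<and> (\<exists>Y. Y \<subseteq> X \<and> Y \<in> snd A e)})"

text \<open>The extension of an object assignment that keeps the ground set to arrows,
  leaving the underlying function unchanged.\<close>

definition identity_on_functions ::
  "('a system \<Rightarrow> 'a system) \<Rightarrow> ('a system, 'a arrow, 'a system, 'a arrow) cat_map" where
  "identity_on_functions \<phi> = \<lparr>onObj = \<phi>, onArr = (\<lambda>(A, f, B). (\<phi> A, f, \<phi> B))\<rparr>"

definition alpha :: "('a system, 'a arrow, 'a system, 'a arrow) cat_map" where
  "alpha = identity_on_functions (\<lambda>A. (fst A, min_enabling A))"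

definition beta :: "('a system, 'a arrow, 'a system, 'a arrow) cat_map" where
  "beta = identity_on_functions (\<lambda>A. (fst A, en_of_dep A))"

end

theory Submission imports Defs begin

text \<open>
  Write \<open>E\<close> for the ground set. On objects, \<open>\<alpha>\<close> and \<open>\<beta>\<close> are inverse because an up-closed family of
  subsets of a finite set is the same thing as an antichain: its minimal members generate it, and
  an antichain is recovered as the family of minimal members of its up-closure
  (\<open>en_of_dep_min_enabling\<close>, \<open>min_enabling_en_of_dep\<close>). The remaining axioms have to be matched,
  and so do the morphisms, which on one side are tested on reachable sets and on the other on
  configurations.

  Both families coincide with the complete sets of the dependency structure. That
  reachable sets and configurations are complete is read off from the last step of the sequences that
  witness them. For the converse (\<open>complete_ranked\<close>) rank an element \<open>e\<close> of a complete set \<open>X\<close> by the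
  least size of a depset of \<open>e\<close> inside \<open>X\<close>. If \<open>D\<close> is such a smallest depset and \<open>d \<in> D\<close>, then, \<open>D\<close>
  being complete, \<open>d\<close> has a depset inside \<open>D\<close>, and by acyclicity this depset misses \<open>d\<close>, so that it is
  smaller than \<open>D\<close>. Hence every element of \<open>X\<close> has a depset consisting of elements of \<open>X\<close> of
  smaller rank. Adding the elements of \<open>X\<close> rank by rank shows that \<open>X\<close> is reachable; listing
  them one after another in order of rank shows that \<open>X\<close> is a configuration.

  Since the two families of test sets agree, the two categories have the same morphisms over
  corresponding objects, and the isomorphism of categories follows.
\<close>

section \<open>Set systems whose arrows are tested on preimages\<close>

text \<open>
  The morphisms of both categories have this form; treating \<open>P\<close> as a parameter lets the category
  and functor laws be checked once.
\<close>

definition preimage_hom ::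
  "('a system \<Rightarrow> 'a set \<Rightarrow> bool) \<Rightarrow> 'a system \<Rightarrow> 'a system \<Rightarrow> ('a \<Rightarrow> 'a) set" where
  "preimage_hom P A B =
     {f \<in> fst A \<rightarrow>\<^sub>E fst B. \<forall>X. P B X \<longrightarrow> P A (f -` X \<inter> fst A)}"

lemma DSC_hom_eq: "DSC_hom = preimage_hom reachable"
  by (intro ext) (simp add: DSC_hom_def preimage_hom_def)

lemma CFES_hom_eq: "CFES_hom = preimage_hom configuration"
  by (intro ext) (simp add: CFES_hom_def preimage_hom_def)

lemma preimage_hom_id:
  assumes "\<And>X. P A X \<Longrightarrow> X \<subseteq> fst A"
  shows "(\<lambda>x\<in>fst A. x) \<in> preimage_hom P A A"
proof -
  have "(\<lambda>x\<in>fst A. x) -` X \<inter> fst A = X" if "P A X" for X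
    using assms[OF that] by auto
  then show ?thesis
    by (auto simp: preimage_hom_def)
qed

lemma preimage_hom_compose:
  assumes f: "f \<in> preimage_hom P A B" and g: "g \<in> preimage_hom P B C"
  shows "compose (fst A) g f \<in> preimage_hom P A C"
proof -
  have f_in: "f \<in> fst A \<rightarrow>\<^sub>E fst B" and g_in: "g \<in> fst B \<rightarrow>\<^sub>E fst C"
    using f g by (auto simp: preimage_hom_def)
  have "P A (compose (fst A) g f -` X \<inter> fst A)" if "P C X" for X
  proof -
    have "P A (f -` (g -` X \<inter> fst B) \<inter> fst A)"
      using f g that unfolding preimage_hom_def by blast
    moreover have "compose (fst A) g f -` X \<inter> fst A = f -` (g -` X \<inter> fst B) \<inter> fst A"
      using f_in by (auto simp: compose_def)
    ultimately show ?thesis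
      by simp
  qed
  moreover have "compose (fst A) g f \<in> fst A \<rightarrow>\<^sub>E fst C"
    using f_in g_in by (auto simp: compose_def)
  ultimately show ?thesis
    by (simp add: preimage_hom_def)
qed

lemma category_preimage_hom:
  assumes P: "\<And>A X. A \<in> S \<Longrightarrow> P A X \<Longrightarrow> X \<subseteq> fst A"
  shows "category (concrete_cat S (preimage_hom P))"
proof -
  have ext: "f \<in> E \<rightarrow>\<^sub>E E'" if "f \<in> preimage_hom P (E, s) (E', s')" for f E s E' s'
    using that by (simp add: preimage_hom_def)
  have idn: "(\<lambda>x\<in>E. x) \<in> preimage_hom P (E, s) (E, s)" if "(E, s) \<in> S" for E s
    using preimage_hom_id[of P "(E, s)"] P[OF that] by simp
  have comp: "compose E g f \<in> preimage_hom P (E, s) C"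
    if "f \<in> preimage_hom P (E, s) B" "g \<in> preimage_hom P B C" for f g E s B C
    using preimage_hom_compose[OF that] by simp
  have idr: "compose E f (\<lambda>x\<in>E. x) = f"
    if "f \<in> preimage_hom P (E, s) (E', s')" for f E s E' s'
    using ext[OF that] by (auto simp: compose_def PiE_def extensional_def fun_eq_iff)
  have idl: "compose E (\<lambda>x\<in>E'. x) f = f"
    if "f \<in> preimage_hom P (E, s) (E', s')" for f E s E' s'
    using ext[OF that] by (fastforce simp: compose_def PiE_def extensional_def fun_eq_iff)
  have assoc: "compose E h (compose E g f) = compose E (compose E' h g) f"
    if "f \<in> preimage_hom P (E, s) (E', s')" for f g h E s E' s'
    using ext[OF that] by (auto simp: compose_def fun_eq_iff)
  show ?thesis
    by standard (auto simp: concrete_cat_def idn intro: comp idr idl assoc)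
qed

lemma is_functor_identity_on_functions:
  assumes "category (concrete_cat S hom)" and "category (concrete_cat T hom')"
    and "\<And>A. A \<in> S \<Longrightarrow> \<phi> A \<in> T"
    and "\<And>A. fst (\<phi> A) = fst A"
    and "\<And>A B f. A \<in> S \<Longrightarrow> B \<in> S \<Longrightarrow> f \<in> hom A B \<Longrightarrow> f \<in> hom' (\<phi> A) (\<phi> B)"
  shows "is_functor (concrete_cat S hom) (concrete_cat T hom') (identity_on_functions \<phi>)"
  unfolding is_functor_def is_functor_axioms_def
  using assms by (auto simp: concrete_cat_def identity_on_functions_def)

lemma mutually_inverse_identity_on_functions:
  assumes "\<And>A. A \<in> S \<Longrightarrow> \<psi> (\<phi> A) = A" and "\<And>B. B \<in> T \<Longrightarrow> \<phi> (\<psi> B) = B"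
  shows "mutually_inverse (concrete_cat S hom) (concrete_cat T hom')
    (identity_on_functions \<phi>) (identity_on_functions \<psi>)"
  using assms by (auto simp: mutually_inverse_def concrete_cat_def identity_on_functions_def)


section \<open>Up-closed families and their minimal members\<close>

lemma min_enabling_below:
  assumes "is_system A" and "e \<in> fst A" and "X \<in> snd A e"
  shows "\<exists>Y \<in> min_enabling A e. Y \<subseteq> X"
proof -
  have "finite (snd A e)"
    using assms by (auto simp: is_system_def PiE_iff intro: finite_subset[of _ "Pow (fst A)"])
  then obtain Y where "Y \<in> snd A e" "Y \<subseteq> X" "\<forall>Z\<in>snd A e. Z \<subseteq> Y \<longrightarrow> Y = Z"
    using finite_has_minimal2[of "snd A e" X] assms(3) by auto
  then show ?thesis
    using assms(2) by (auto simp: min_enabling_def)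
qed

lemma is_system_min_enabling:
  assumes "is_system A"
  shows "is_system (fst A, min_enabling A)"
  using assms by (auto simp: is_system_def min_enabling_def PiE_iff)

lemma is_CFES_en_of_dep:
  assumes "is_system A"
  shows "is_CFES (fst A, en_of_dep A)"
  unfolding is_CFES_def
proof (intro conjI ballI allI impI)
  show "is_system (fst A, en_of_dep A)"
    using assms by (auto simp: is_system_def en_of_dep_def)
  fix e X Y
  assume "e \<in> fst (fst A, en_of_dep A)" "X \<in> snd (fst A, en_of_dep A) e"
    and "X \<subseteq> Y" "Y \<subseteq> fst (fst A, en_of_dep A)"
  then show "Y \<in> snd (fst A, en_of_dep A) e"
    by (simp add: en_of_dep_def) (blast intro: subset_trans)
qed

lemma en_of_dep_min_enabling:
  assumes "is_CFES A"
  shows "(fst A, en_of_dep (fst A, min_enabling A)) = A"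
proof -
  have sys: "is_system A"
    and up: "\<And>e X Y. e \<in> fst A \<Longrightarrow> X \<in> snd A e \<Longrightarrow> X \<subseteq> Y \<Longrightarrow> Y \<subseteq> fst A \<Longrightarrow> Y \<in> snd A e"
    using assms by (auto simp: is_CFES_def)
  have "en_of_dep (fst A, min_enabling A) e = snd A e" for e
  proof (cases "e \<in> fst A")
    case True
    have "X \<in> snd A e \<longleftrightarrow> X \<subseteq> fst A \<and> (\<exists>Y\<in>min_enabling A e. Y \<subseteq> X)" for X
    proof
      assume X: "X \<in> snd A e"
      then have "X \<subseteq> fst A"
        using sys True by (auto simp: is_system_def PiE_iff)
      then show "X \<subseteq> fst A \<and> (\<exists>Y\<in>min_enabling A e. Y \<subseteq> X)"
        using min_enabling_below[OF sys True X] by blast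
    next
      assume "X \<subseteq> fst A \<and> (\<exists>Y\<in>min_enabling A e. Y \<subseteq> X)"
      then show "X \<in> snd A e"
        using True by (auto simp: min_enabling_def intro: up)
    qed
    then show ?thesis
      using True by (auto simp: en_of_dep_def Bex_def conj_commute)
  next
    case False
    then show ?thesis
      using sys by (auto simp: en_of_dep_def is_system_def PiE_iff extensional_def)
  qed
  then show ?thesis
    by (auto simp: prod_eq_iff)
qed

lemma min_enabling_en_of_dep:
  assumes sys: "is_system A"
    and irr: "\<And>e D0 D1. e \<in> fst A \<Longrightarrow> D0 \<in> snd A e \<Longrightarrow> D1 \<in> snd A e \<Longrightarrow> D0 \<subseteq> D1 \<Longrightarrow> D0 = D1"
  shows "(fst A, min_enabling (fst A, en_of_dep A)) = A"
proof -
  have "min_enabling (fst A, en_of_dep A) e = snd A e" for e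
  proof (cases "e \<in> fst A")
    case True
    have sub: "D \<subseteq> fst A" if "D \<in> snd A e" for D
      using sys True that by (auto simp: is_system_def PiE_iff)
    have en: "X \<in> en_of_dep A e \<longleftrightarrow> X \<subseteq> fst A \<and> (\<exists>Y\<in>snd A e. Y \<subseteq> X)" for X
      using True by (auto simp: en_of_dep_def)
    have "X \<in> min_enabling (fst A, en_of_dep A) e \<longleftrightarrow> X \<in> snd A e" for X
    proof
      assume "X \<in> min_enabling (fst A, en_of_dep A) e"
      then have X: "X \<in> en_of_dep A e" and min: "\<And>Y. Y \<subseteq> X \<Longrightarrow> Y \<in> en_of_dep A e \<Longrightarrow> Y = X"
        using True by (auto simp: min_enabling_def)
      obtain Y where Y: "Y \<in> snd A e" "Y \<subseteq> X"
        using X by (auto simp: en)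
      then have "Y \<in> en_of_dep A e"
        using sub by (auto simp: en)
      then show "X \<in> snd A e"
        using min Y by blast
    next
      assume X: "X \<in> snd A e"
      have "Y = X" if YX: "Y \<subseteq> X" and Y: "Y \<in> en_of_dep A e" for Y
      proof -
        obtain Z where Z: "Z \<in> snd A e" "Z \<subseteq> Y"
          using Y by (auto simp: en)
        then have "Z = X"
          using irr[OF True Z(1) X] YX by blast
        then show ?thesis
          using Z YX by blast
      qed
      then show "X \<in> min_enabling (fst A, en_of_dep A) e"
        using X sub[OF X] True by (auto simp: min_enabling_def en)
    qed
    then show ?thesis
      by blast
  next
    case False
    then show ?thesis
      using sys by (auto simp: min_enabling_def is_system_def PiE_iff extensional_def)
  qed
  then show ?thesis
    by (auto simp: prod_eq_iff)
qed


section \<open>Reachable sets, configurations and complete sets\<close>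

lemma reachable_imp_complete:
  assumes "reachable A X"
  shows "complete A X"
  using assms by (auto simp: reachable_def rch_def complete_def) (meson subset_trans)

lemma configuration_has_enabling_subset:
  assumes "configuration A X" and "e \<in> X"
  shows "\<exists>Y\<in>snd A e. Y \<subseteq> X"
proof -
  obtain n :: nat and s
    where s: "\<forall>i\<le>n. s i \<in> X" "s n = e" "\<forall>i\<le>n. s ` {..<i} \<in> snd A (s i)"
    using assms unfolding configuration_def by blast
  have "s ` {..<n} \<in> snd A e"
    using s(2,3) by auto
  moreover have "s ` {..<n} \<subseteq> X"
    using s(1) by auto
  ultimately show ?thesis
    by blast
qed

lemma configuration_en_of_dep_imp_complete:
  assumes "configuration (fst A, en_of_dep A) X"
  shows "complete A X"
  unfolding complete_def
proof (intro conjI ballI)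
  show sub: "X \<subseteq> fst A"
    using assms by (simp add: configuration_def)
  fix e assume e: "e \<in> X"
  then obtain Y where Y: "Y \<in> en_of_dep A e" "Y \<subseteq> X"
    using configuration_has_enabling_subset[OF assms] by auto
  moreover have "e \<in> fst A"
    using e sub by blast
  ultimately obtain D where "D \<in> snd A e" "D \<subseteq> Y"
    by (auto simp: en_of_dep_def)
  then show "\<exists>D\<in>snd A e. D \<subseteq> X"
    using Y(2) by blast
qed

text \<open>
  The minimal size of a depset inside \<open>X\<close> is a rank: inside a complete depset of minimal size,
  every element has, by acyclicity, a strictly smaller depset. Arguing with minimal sizes avoids
  an induction over the dependencies.
\<close>

lemma complete_ranked:
  assumes A: "is_DSC A" and X: "complete A X"
  obtains r :: "'a \<Rightarrow> nat" where "\<And>e. e \<in> X \<Longrightarrow> \<exists>D\<in>snd A e. D \<subseteq> {x \<in> X. r x < r e}"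
proof
  define r where "r e = (LEAST n. \<exists>D\<in>snd A e. D \<subseteq> X \<and> card D = n)" for e
  have r_le: "r e \<le> card D" if "D \<in> snd A e" "D \<subseteq> X" for e D
    unfolding r_def using that by (intro Least_le) blast
  fix e assume e: "e \<in> X"
  have "\<exists>n. \<exists>D\<in>snd A e. D \<subseteq> X \<and> card D = n"
    using X e unfolding complete_def by blast
  then have "\<exists>D\<in>snd A e. D \<subseteq> X \<and> card D = r e"
    unfolding r_def by (rule LeastI_ex)
  then obtain D where D: "D \<in> snd A e" "D \<subseteq> X" "card D = r e"
    by blast
  have XA: "X \<subseteq> fst A" and "finite (fst A)"
    using A X by (auto simp: is_DSC_def is_system_def complete_def)
  then have "finite D" and eA: "e \<in> fst A"
    using D(2) e by (auto dest: finite_subset)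
  have D_complete: "complete A D"
    using A D(1) eA by (simp add: is_DSC_def)
  have "r d < r e" if d: "d \<in> D" for d
  proof -
    obtain D' where D': "D' \<in> snd A d" "D' \<subseteq> D"
      using D_complete d by (auto simp: complete_def)
    have "d \<in> fst A"
      using d D(2) XA by blast
    then have "d \<notin> D'"
      using A D'(1) by (simp add: is_DSC_def)
    then have "D' \<subset> D"
      using D'(2) d by blast
    then have "card D' < card D"
      by (rule psubset_card_mono[OF \<open>finite D\<close>])
    moreover have "r d \<le> card D'"
      using r_le D' D(2) by blast
    ultimately show ?thesis
      using D(3) by simp
  qed
  then show "\<exists>D\<in>snd A e. D \<subseteq> {x \<in> X. r x < r e}"
    using D(1,2) by blast
qed

lemma complete_imp_reachable:
  assumes A: "is_DSC A" and X: "complete A X"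
  shows "reachable A X"
proof -
  obtain r :: "'a \<Rightarrow> nat"
    where r: "\<And>e. e \<in> X \<Longrightarrow> \<exists>D\<in>snd A e. D \<subseteq> {x \<in> X. r x < r e}"
    using complete_ranked[OF A X] by blast
  define S where "S n = {e \<in> X. r e < n}" for n
  have XA: "X \<subseteq> fst A" and "finite X"
    using A X by (auto simp: is_DSC_def is_system_def complete_def dest: finite_subset)
  have step: "rch A (S n) (S (Suc n))" for n
    unfolding rch_def
  proof (intro conjI ballI)
    fix e assume e: "e \<in> S (Suc n)"
    then obtain D where "D \<in> snd A e" "D \<subseteq> {x \<in> X. r x < r e}"
      using r by (auto simp: S_def)
    then show "\<exists>D\<in>snd A e. D \<subseteq> S n"
      using e by (auto simp: S_def intro!: bexI[of _ D])
  qed (use XA in \<open>auto simp: S_def\<close>)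
  obtain n where n: "\<forall>e\<in>X. r e < n"
    using \<open>finite X\<close> finite_nat_set_iff_bounded[of "r ` X"] by auto
  then have "S n = X"
    by (auto simp: S_def)
  \<comment> \<open>\<open>S 0\<close> is empty, so the chain starts trivially; it ends by staying at \<open>X\<close>.\<close>
  moreover have "rch A {} (S 0)"
    by (simp add: rch_def S_def)
  moreover have "rch A X X"
    using X by (simp add: rch_def complete_def)
  ultimately show ?thesis
    using step XA unfolding reachable_def by metis
qed

lemma complete_imp_configuration:
  assumes A: "is_DSC A" and X: "complete A X"
  shows "configuration (fst A, en_of_dep A) X"
proof -
  obtain r :: "'a \<Rightarrow> nat"
    where r: "\<And>e. e \<in> X \<Longrightarrow> \<exists>D\<in>snd A e. D \<subseteq> {x \<in> X. r x < r e}"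
    using complete_ranked[OF A X] by blast
  have XA: "X \<subseteq> fst A" and "finite X"
    using A X by (auto simp: is_DSC_def is_system_def complete_def dest: finite_subset)
  obtain ys where "set ys = X"
    using finite_list[OF \<open>finite X\<close>] by blast
  define xs where "xs = sort_key r ys"
  have set_xs: "set xs = X" and sorted: "sorted (map r xs)"
    using \<open>set ys = X\<close> by (simp_all add: xs_def)
  have prefix: "(!) xs ` {..<i} \<in> en_of_dep A (xs ! i)" if i: "i < length xs" for i
  proof -
    have "xs ! i \<in> X"
      using i set_xs nth_mem by blast
    then obtain D where D: "D \<in> snd A (xs ! i)" "D \<subseteq> {x \<in> X. r x < r (xs ! i)}"
      using r by blast
    \<comment> \<open>In the sorted list, elements of smaller rank occur at smaller positions.\<close>
    have "D \<subseteq> (!) xs ` {..<i}"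
    proof
      fix d assume "d \<in> D"
      then have "d \<in> set xs" and rd: "r d < r (xs ! i)"
        using D(2) set_xs by auto
      then obtain j where j: "j < length xs" "xs ! j = d"
        by (auto simp: in_set_conv_nth)
      have "j < i"
      proof (rule ccontr)
        assume "\<not> j < i"
        then have "r (xs ! i) \<le> r (xs ! j)"
          using sorted_nth_mono[OF sorted, of i j] i j(1) by simp
        then show False
          using rd j(2) by simp
      qed
      then show "d \<in> (!) xs ` {..<i}"
        using j(2) by blast
    qed
    moreover have "(!) xs ` {..<i} \<subseteq> X"
      using i set_xs by (auto intro!: nth_mem)
    ultimately show ?thesis
      using D(1) XA \<open>xs ! i \<in> X\<close> by (auto simp: en_of_dep_def)
  qed
  show ?thesis
    unfolding configuration_def
  proof (intro conjI ballI)
    fix e assume "e \<in> X"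
    then obtain n where n: "n < length xs" "xs ! n = e"
      using set_xs by (auto simp: in_set_conv_nth)
    have "\<forall>i\<le>n. xs ! i \<in> X"
      using n(1) set_xs by (auto intro!: nth_mem)
    moreover have "\<forall>i\<le>n. (!) xs ` {..<i} \<in> snd (fst A, en_of_dep A) (xs ! i)"
      using n(1) prefix by simp
    ultimately show "\<exists>(n::nat) s. (\<forall>i\<le>n. s i \<in> X) \<and> s n = e \<and>
        (\<forall>i\<le>n. s ` {..<i} \<in> snd (fst A, en_of_dep A) (s i))"
      using n(2) by blast
  qed (use XA in simp)
qed

lemma configuration_en_of_dep_iff_reachable:
  assumes "is_DSC A"
  shows "configuration (fst A, en_of_dep A) X \<longleftrightarrow> reachable A X"
  using assms configuration_en_of_dep_imp_complete complete_imp_configuration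
    reachable_imp_complete complete_imp_reachable by blast


section \<open>The two assignments on objects and morphisms\<close>

lemma min_enabling_en_of_dep_DSC:
  assumes "is_DSC A"
  shows "(fst A, min_enabling (fst A, en_of_dep A)) = A"
  using assms by (intro min_enabling_en_of_dep) (auto simp: is_DSC_def)

lemma en_of_dep_min_enabling_DES:
  assumes "is_DES A"
  shows "(fst A, en_of_dep (fst A, min_enabling A)) = A"
  using assms by (intro en_of_dep_min_enabling) (simp add: is_DES_def)

text \<open>
  A configuration is complete for the minimal enabling sets, because each of its elements is
  enabled by a subset of it and hence has a minimal enabling set inside it.
\<close>

lemma is_DSC_min_enabling:
  assumes A: "is_DES A"
  shows "is_DSC (fst A, min_enabling A)"
proof -
  have sys: "is_system A"
    using A by (simp add: is_DES_def is_CFES_def)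
  have complete: "complete (fst A, min_enabling A) D"
    if "e \<in> fst A" "D \<in> min_enabling A e" for e D
  proof -
    have conf: "configuration A D"
      using A that by (simp add: is_DES_def)
    then have sub: "D \<subseteq> fst A"
      by (simp add: configuration_def)
    have "\<exists>Y\<in>min_enabling A d. Y \<subseteq> D" if d: "d \<in> D" for d
    proof -
      obtain Y where "Y \<in> snd A d" "Y \<subseteq> D"
        using configuration_has_enabling_subset[OF conf d] by blast
      then show ?thesis
        using min_enabling_below[OF sys, of d Y] sub d by blast
    qed
    then show ?thesis
      using sub by (simp add: complete_def)
  qed
  have nonempty: "min_enabling A e \<noteq> {}" if "e \<in> fst A" for e
  proof -
    have "snd A e \<noteq> {}"
      using A that by (simp add: is_DES_def)
    then show ?thesis
      using min_enabling_below[OF sys that] by fast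
  qed
  have irr: "D0 = D1"
    if "e \<in> fst A" "D0 \<in> min_enabling A e" "D1 \<in> min_enabling A e" "D0 \<subseteq> D1" for e D0 D1
    using that by (auto simp: min_enabling_def)
  show ?thesis
    unfolding is_DSC_def
    using A is_system_min_enabling[OF sys] complete nonempty irr by (simp add: is_DES_def)
qed

lemma is_DES_en_of_dep:
  assumes A: "is_DSC A"
  shows "is_DES (fst A, en_of_dep A)"
proof -
  have min: "min_enabling (fst A, en_of_dep A) = snd A"
    using min_enabling_en_of_dep_DSC[OF A] by (metis snd_conv)
  have sub: "D \<subseteq> fst A" if "e \<in> fst A" "D \<in> snd A e" for e D
    using A that by (auto simp: is_DSC_def complete_def)
  have "en_of_dep A e \<noteq> {}" if e: "e \<in> fst A" for e
  proof -
    have "snd A e \<noteq> {}"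
      using A e by (simp add: is_DSC_def)
    then obtain D where "D \<in> snd A e"
      by blast
    then have "D \<in> en_of_dep A e"
      using sub e by (auto simp: en_of_dep_def)
    then show ?thesis
      by blast
  qed
  moreover have "is_CFES (fst A, en_of_dep A)"
    using A by (intro is_CFES_en_of_dep) (simp add: is_DSC_def)
  ultimately show ?thesis
    using A complete_imp_configuration[OF A] by (simp add: is_DES_def is_DSC_def min)
qed

lemma CFES_hom_en_of_dep:
  assumes "is_DSC A" and "is_DSC B"
  shows "CFES_hom (fst A, en_of_dep A) (fst B, en_of_dep B) = DSC_hom A B"
  using assms by (simp add: CFES_hom_def DSC_hom_def configuration_en_of_dep_iff_reachable)

lemma DSC_hom_min_enabling:
  assumes "is_DES A" and "is_DES B"
  shows "DSC_hom (fst A, min_enabling A) (fst B, min_enabling B) = CFES_hom A B"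
  using CFES_hom_en_of_dep[OF is_DSC_min_enabling[OF assms(1)] is_DSC_min_enabling[OF assms(2)]]
    en_of_dep_min_enabling_DES[OF assms(1)] en_of_dep_min_enabling_DES[OF assms(2)]
  by simp


section \<open>The isomorphism of categories\<close>

lemma DES_eq: "DES = concrete_cat {A. is_DES A} CFES_hom"
  by (auto simp: DES_def CFES_def full_subcategory_def concrete_cat_def is_DES_def)

lemma category_DES: "category DES"
  unfolding DES_eq CFES_hom_eq
  by (rule category_preimage_hom) (simp add: configuration_def)

lemma category_DSC: "category DSC"
  unfolding DSC_def DSC_hom_eq
  by (rule category_preimage_hom) (simp add: reachable_def)

lemma is_functor_alpha: "is_functor DES DSC alpha"
  using category_DES category_DSC
  unfolding DES_eq DSC_def alpha_def
  by (rule is_functor_identity_on_functions) (simp_all add: is_DSC_min_enabling DSC_hom_min_enabling)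

lemma is_functor_beta: "is_functor DSC DES beta"
  using category_DSC category_DES
  unfolding DES_eq DSC_def beta_def
  by (rule is_functor_identity_on_functions) (simp_all add: is_DES_en_of_dep CFES_hom_en_of_dep)

lemma mutually_inverse_alpha_beta: "mutually_inverse DES DSC alpha beta"
  unfolding DES_eq DSC_def alpha_def beta_def
  by (rule mutually_inverse_identity_on_functions)
    (simp_all add: en_of_dep_min_enabling_DES min_enabling_en_of_dep_DSC)

theorem theorem5p12:
  shows "category (DES :: ('a system, 'a arrow) cat)
    \<and> category (DSC :: ('a system, 'a arrow) cat)
    \<and> is_functor (DES :: ('a system, 'a arrow) cat) DSC alpha
    \<and> is_functor (DSC :: ('a system, 'a arrow) cat) DES beta
    \<and> mutually_inverse (DES :: ('a system, 'a arrow) cat) DSC alpha beta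
    \<and> isomorphic_categories (DES :: ('a system, 'a arrow) cat) (DSC :: ('a system, 'a arrow) cat)"
  using category_DES category_DSC is_functor_alpha is_functor_beta mutually_inverse_alpha_beta
  unfolding isomorphic_categories_def by blast

end
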